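(* Let $x$ and $s$ be positive integers. The infinite continued fraction $$F(x,s):=\left[x,\frac{s}{x},x^2,\frac{s}{x^2},x^3,\frac{s}{x^3},x^4,\frac{s}{x^4},\dots,x^k,\frac{s}{x^k},\dots\right]$$ converges to the positive root (in $z$) of the quadratic $P(x,z,s)=sz^2-((s+1)x-1)z-x$.
   Context: For positive real numbers $b_0,b_1,b_2,\dots$, $[b_0,b_1,\dots,b_n]$ denotes the finite continued fraction $b_0+\cfrac{1}{b_1+\cfrac{1}{b_2+\cdots+\cfrac{1}{b_n}}}$ (the partial quotients need not be integers). The infinite continued fraction $[b_0,b_1,b_2,\dots]$ converges to $L$ if its sequence of convergents $[b_0,b_1,\dots,b_n]$ tends to $L$ as $n\to\infty$. In $F(x,s)$ the partial quotients are $b_{2i-2}=x^i$ and $b_{2i-1}=s/x^i$ for $i\ge1$. *)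

theory Defs
  imports Complex_Main
begin

text \<open>The value of the empty list is a dummy: continued fractions have at least one
  partial quotient.\<close>

fun cfrac :: "real list \<Rightarrow> real" where
  "cfrac [] = 0"
| "cfrac [b] = b"
| "cfrac (b # c # bs) = b + 1 / cfrac (c # bs)"

definition convergent_at :: "(nat \<Rightarrow> real) \<Rightarrow> nat \<Rightarrow> real" where
  "convergent_at b n = cfrac (map b [0..<Suc n])"

definition cfrac_converges_to :: "(nat \<Rightarrow> real) \<Rightarrow> real \<Rightarrow> bool" where
  "cfrac_converges_to b L \<longleftrightarrow> convergent_at b \<longlonglongrightarrow> L"

text \<open>Both indices \<open>n = 2 * i - 2\<close> and \<open>n = 2 * i - 1\<close> (for \<open>i \<ge> 1\<close>) satisfy
  \<open>Suc (n div 2) = i\<close>.\<close>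

definition F :: "nat \<Rightarrow> nat \<Rightarrow> nat \<Rightarrow> real" where
  "F x s n = (if even n then real x ^ Suc (n div 2) else real s / real x ^ Suc (n div 2))"

definition P :: "real \<Rightarrow> real \<Rightarrow> real \<Rightarrow> real" where
  "P x z s = s * z\<^sup>2 - ((s + 1) * x - 1) * z - x"

end

theory Submission
  imports Defs
begin

text \<open>Multiplying the partial quotients of a continued fraction alternately by \<open>x\<close> and \<open>1/x\<close>
  multiplies its value by \<open>x\<close>. Dropping the first two partial quotients of \<open>F(x,s)\<close> has exactly
  this effect, so its convergents \<open>c\<^sub>n\<close> satisfy \<open>c\<^sub>n\<^sub>+\<^sub>2 = T(c\<^sub>n)\<close> with
  \<open>T(c) = x + x c / (s c + 1)\<close>. The fixed points of \<open>T\<close> are the roots of \<open>P\<close>, and \<open>T\<close> is a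
  contraction with constant \<open>1/2\<close> on \<open>[x, \<infinity>)\<close>.\<close>

lemma hd_le_cfrac:
  assumes "bs \<noteq> []" and "\<And>b. b \<in> set bs \<Longrightarrow> b > 0"
  shows "hd bs \<le> cfrac bs"
  using assms
proof (induction bs rule: cfrac.induct)
  case (3 b c bs)
  then have "c \<le> cfrac (c # bs)" and "c > 0"
    by simp_all
  then show ?case
    by simp
qed simp_all

text \<open>The case \<open>bs = []\<close> holds because \<open>1 / cfrac [] = 1 / 0 = 0\<close>.\<close>

lemma cfrac_Cons: "cfrac (b # bs) = b + 1 / cfrac bs"
  by (cases bs) simp_all

text \<open>As \<open>1 / (c * t) = (1 / c) * (1 / t)\<close>, the factor inverts at each level,
  matching the alternation. The start \<open>m\<close> is arbitrary because peeling off the head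
  flips its parity.\<close>

lemma cfrac_scale_alternating:
  fixes f g :: "nat \<Rightarrow> real"
  assumes "c \<noteq> 0"
    and g: "\<And>k. g k = (if even k then c * f k else f k / c)"
  shows "cfrac (map g [m..<m + n]) =
    (if even m then c else 1 / c) * cfrac (map f [m..<m + n])"
proof (induction n arbitrary: m)
  case (Suc n)
  have "[m..<m + Suc n] = m # [Suc m..<Suc m + n]"
    by (simp add: upt_conv_Cons del: upt_Suc)
  then show ?case
    using Suc.IH[of "Suc m"] \<open>c \<noteq> 0\<close>
    by (simp add: cfrac_Cons g distrib_left del: upt_Suc)
qed simp

lemma F_pos:
  assumes "x > 0" and "s > 0"
  shows "F x s n > 0"
  using assms by (simp add: F_def)

text \<open>Places every convergent where \<open>contraction_half\<close> applies.\<close>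

lemma convergent_at_F_ge:
  assumes "x > 0" and "s > 0"
  shows "real x \<le> convergent_at (F x s) n"
proof -
  have "hd (map (F x s) [0..<Suc n]) \<le> convergent_at (F x s) n"
    unfolding convergent_at_def using F_pos[OF assms] by (intro hd_le_cfrac) auto
  moreover have "hd (map (F x s) [0..<Suc n]) = real x"
    by (simp add: hd_map F_def del: upt_Suc)
  ultimately show ?thesis
    by simp
qed

lemma convergent_at_F_Suc_Suc:
  fixes x s n :: nat
  defines "c \<equiv> convergent_at (F x s) n"
  assumes "x > 0" and "s > 0"
  shows "convergent_at (F x s) (Suc (Suc n)) = real x + real x * c / (real s * c + 1)"
proof -
  have shift: "F x s (Suc (Suc k)) = (if even k then x * F x s k else F x s k / x)" for k
    by (simp add: F_def)
  \<comment> \<open>The bound \<open>0 + Suc n\<close> fits the scaling lemma with the even start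
    \<open>m = 0\<close>, so the factor is \<open>x\<close>.\<close>
  have tail: "cfrac (map (\<lambda>k. F x s (Suc (Suc k))) [0..<0 + Suc n]) = x * c"
    using \<open>x > 0\<close> shift
    by (subst cfrac_scale_alternating[of "real x" _ "F x s"])
      (simp_all add: c_def convergent_at_def del: upt_Suc)
  have "convergent_at (F x s) (Suc (Suc n)) =
      F x s 0 + 1 / (F x s 1 + 1 / cfrac (map (\<lambda>k. F x s (Suc (Suc k))) [0..<0 + Suc n]))"
    unfolding convergent_at_def map_upt_Suc[of _ "Suc (Suc n)"] map_upt_Suc[of _ "Suc n"]
    by (simp add: cfrac_Cons del: upt_Suc)
  then have "convergent_at (F x s) (Suc (Suc n)) = x + 1 / (s / x + 1 / (x * c))"
    unfolding tail by (simp add: F_def)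
  moreover have "c > 0"
    using convergent_at_F_ge[OF assms(2,3), of n] \<open>x > 0\<close> by (simp add: c_def)
  ultimately show ?thesis
    using \<open>x > 0\<close> by (simp add: field_simps)
qed

text \<open>Clear the positive denominator \<open>s * z + 1\<close> and collect powers of
  \<open>z\<close>.\<close>

lemma P_eq_0_iff:
  assumes "s \<ge> 0" and "z > 0"
  shows "P x z s = 0 \<longleftrightarrow> z = x + x * z / (s * z + 1)"
proof -
  have "s * z + 1 > 0"
    using assms by (simp add: add_nonneg_pos)
  then show ?thesis
    unfolding P_def by (auto simp: field_simps power2_eq_square)
qed

lemma P_positive_root_exists:
  assumes "x > 0" and "s > 0"
  shows "\<exists>z>0. P x z s = 0"
proof -
  define A where "A = (s + 1) * x - 1"
  define z where "z = (A + sqrt (A\<^sup>2 + 4 * s * x)) / (2 * s)"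
  \<comment> \<open>Strict since \<open>4 * s * x > 0\<close>; so the numerator of \<open>z\<close>
    is positive even if \<open>A\<close> is negative.\<close>
  have "\<bar>A\<bar> < sqrt (A\<^sup>2 + 4 * s * x)"
    using assms by (intro real_less_rsqrt) simp
  then have "z > 0"
    using assms by (simp add: z_def)
  moreover have "P x z s = 0"
  proof -
    have "2 * s * z - A = sqrt (A\<^sup>2 + 4 * s * x)"
      using assms by (simp add: z_def)
    then have "(2 * s * z - A)\<^sup>2 = A\<^sup>2 + 4 * s * x"
      using assms by simp
    \<comment> \<open>Completing the square.\<close>
    moreover have "4 * s * P x z s = (2 * s * z - A)\<^sup>2 - (A\<^sup>2 + 4 * s * x)"
      unfolding P_def A_def[symmetric] by (simp add: power2_eq_square algebra_simps)
    ultimately have "4 * s * P x z s = 0"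
      by simp
    then show ?thesis
      using assms by simp
  qed
  ultimately show ?thesis
    by blast
qed

text \<open>The combination \<open>z * P x w s - w * P x z s\<close> cancels the linear terms and
  leaves \<open>w - z\<close> times a positive factor.\<close>

lemma P_positive_root_unique:
  assumes "x > 0" and "s > 0" and "z > 0" "P x z s = 0" and "w > 0" "P x w s = 0"
  shows "w = z"
proof -
  have "(w - z) * (s * w * z + x) = z * P x w s - w * P x z s"
    by (simp add: P_def power2_eq_square algebra_simps)
  moreover have "s * w * z + x > 0"
    using assms by (simp add: add_pos_pos)
  ultimately show ?thesis
    using assms by simp
qed

text \<open>In the difference quotient \<open>x / ((s * c + 1) * (s * z + 1))\<close>, the first
  factor is at least \<open>x\<close> and absorbs the numerator; the second is at least 2 and gives
  the half.\<close>

lemma contraction_half: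
  fixes x s c z :: real
  assumes "x \<ge> 1" "s \<ge> 1" "c \<ge> x" "z \<ge> x"
  shows "\<bar>(x + x * c / (s * c + 1)) - (x + x * z / (s * z + 1))\<bar> \<le> \<bar>c - z\<bar> / 2"
proof -
  have "1 * x \<le> s * c" "1 * 1 \<le> s * z"
    using assms by (intro mult_mono; linarith)+
  then have c: "s * c + 1 \<ge> x" and z: "s * z + 1 \<ge> 2"
    by simp_all
  have "(x + x * c / (s * c + 1)) - (x + x * z / (s * z + 1))
      = x * (c - z) / ((s * c + 1) * (s * z + 1))"
    using c z assms by (simp add: divide_simps) (simp add: algebra_simps)
  also have "\<bar>\<dots>\<bar> = x * \<bar>c - z\<bar> / ((s * c + 1) * (s * z + 1))"
    using c z assms by (simp add: abs_mult)
  also have "\<dots> \<le> x * \<bar>c - z\<bar> / (x * 2)"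
    using c z assms by (intro divide_left_mono mult_mono mult_pos_pos mult_nonneg_nonneg) auto
  finally show ?thesis
    using assms by simp
qed

lemma tendsto_of_two_step_contraction:
  fixes c :: "nat \<Rightarrow> real"
  assumes step: "\<And>n. \<bar>c (Suc (Suc n)) - z\<bar> \<le> \<bar>c n - z\<bar> / 2"
  shows "c \<longlonglongrightarrow> z"
proof -
  \<comment> \<open>Even and odd indices contract separately, so \<open>K\<close> must dominate both
    initial errors.\<close>
  define K where "K = \<bar>c 0 - z\<bar> + \<bar>c 1 - z\<bar>"
  have bound: "\<bar>c n - z\<bar> \<le> K * (1 / 2) ^ (n div 2)" for n
  proof (induction n rule: nat_induct2)
    case (step n)
    then show ?case
      using assms[of n] by simp
  qed (simp_all add: K_def)
  have "filterlim (\<lambda>n::nat. n div 2) at_top sequentially"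
    unfolding filterlim_at_top
    by (metis (no_types, lifting) div_le_mono eventually_at_top_linorder
        nonzero_mult_div_cancel_right zero_neq_numeral)
  then have "(\<lambda>n. (1 / 2 :: real) ^ (n div 2)) \<longlonglongrightarrow> 0"
    by (rule filterlim_compose[OF LIMSEQ_power_zero, rotated]) simp
  then have "(\<lambda>n. K * (1 / 2) ^ (n div 2)) \<longlonglongrightarrow> 0"
    by (rule tendsto_mult_right_zero)
  then have "(\<lambda>n. c n - z) \<longlonglongrightarrow> 0"
    by (rule tendsto_0_le[where K = 1]) (use bound K_def in simp)
  then show ?thesis
    by (simp add: LIM_zero_iff)
qed

theorem theorem16:
  fixes x s :: nat
  assumes "x > 0" and "s > 0"
  shows "\<exists>z. z > 0 \<and> P (real x) z (real s) = 0
             \<and> (\<forall>w. w > 0 \<and> P (real x) w (real s) = 0 \<longrightarrow> w = z)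
             \<and> cfrac_converges_to (F x s) z"
proof -
  obtain z where z: "z > 0" "P (real x) z (real s) = 0"
    using P_positive_root_exists[of "real x" "real s"] assms by auto
  then have fixpoint: "z = real x + real x * z / (real s * z + 1)"
    by (simp add: P_eq_0_iff)
  \<comment> \<open>Puts the fixed point, too, in the domain of the contraction.\<close>
  have "real x * z / (real s * z + 1) \<ge> 0"
    using z by simp
  then have "z \<ge> real x"
    using fixpoint by linarith
  have "convergent_at (F x s) \<longlonglongrightarrow> z"
  proof (rule tendsto_of_two_step_contraction)
    show "\<bar>convergent_at (F x s) (Suc (Suc n)) - z\<bar> \<le> \<bar>convergent_at (F x s) n - z\<bar> / 2" for n
      using contraction_half[of "real x" "real s" "convergent_at (F x s) n" z]
        convergent_at_F_ge[OF assms, of n] convergent_at_F_Suc_Suc[OF assms, of n]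
        \<open>z \<ge> real x\<close> assms fixpoint
      by simp
  qed
  moreover have "\<forall>w. w > 0 \<and> P (real x) w (real s) = 0 \<longrightarrow> w = z"
    using P_positive_root_unique[OF _ _ z] assms of_nat_0_less_iff by blast
  ultimately show ?thesis
    using z unfolding cfrac_converges_to_def by blast
qed

end
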